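(* Let $n\ge1$, $0<k\le1$, and let $P\in\mathscr P_n$ have no zero in the disk $|z|<k$. Then for all $\alpha,\beta\in\mathbb C$ with $|\alpha|\le1$, $|\beta|\le1$, all $R>r\ge k$ and all $|z|=1$, writing $\Phi=\Phi_k(R,r,\alpha,\beta)$, $$\big|B[P\circ\sigma](z)+\Phi B[P\circ\rho](z)\big|\le\frac12\Big[\Big\{\tfrac{|B[z^n]|}{k^n}|R^n+r^n\Phi|+|1+\Phi||\lambda_0|\Big\}\max_{|z|=k}|P(z)|-\Big\{\tfrac{|B[z^n]|}{k^n}|R^n+r^n\Phi|-|1+\Phi||\lambda_0|\Big\}\min_{|z|=k}|P(z)|\Big].$$
   Context: For an integer $n\ge1$, $\mathscr P_n$ denotes the set of complex polynomials of degree at most $n$. Fix complex numbers $\lambda_0,\lambda_1,\lambda_2$ such that all zeros of $U(z)=\lambda_0+n\lambda_1 z+\frac{n(n-1)}{2}\lambda_2 z^2$ lie in the half-plane $\{z\in\mathbb C:|z|\le|z-n/2|\}$. The operator $B$ (of the class $\mathcal B_n$) sends $P\in\mathscr P_n$ to $B[P](z)=\lambda_0P(z)+\lambda_1\frac{nz}{2}P'(z)+\lambda_2\left(\frac{nz}{2}\right)^2\frac{P''(z)}{2!}$. For a polynomial $P$ and a map $\rho$, $P\circ\rho$ denotes $z\mapsto P(\rho(z))$, and $B[P\circ\rho](z)$ is $B$ applied to the polynomial $P\circ\rho$, evaluated at $z$. $B[z^n]$ denotes $B$ applied to the monomial $z\mapsto z^n$, evaluated at the point $z$ under consideration; thus $|B[z^n]|=|z|^n\,|\lambda_0+\lambda_1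 n^2/2+\lambda_2 n^3(n-1)/8|$. For $k>0$, $R,r>0$ and $\alpha,\beta\in\mathbb C$: $\Phi_k(R,r,\alpha,\beta)=\beta\left\{\left(\frac{R+k}{k+r}\right)^n-|\alpha|\right\}-\alpha$; and $\sigma(z)=Rz$, $\rho(z)=rz$. *)

theory Defs
  imports "HOL-Analysis.Analysis" "HOL-Computational_Algebra.Polynomial"
begin

definition Bop :: "nat \<Rightarrow> complex \<Rightarrow> complex \<Rightarrow> complex \<Rightarrow> complex poly \<Rightarrow> complex \<Rightarrow> complex" where
  "Bop n l0 l1 l2 P z =
     l0 * poly P z
     + l1 * (of_nat n * z / 2) * poly (pderiv P) z
     + l2 * (of_nat n * z / 2)^2 * poly (pderiv (pderiv P)) z / 2"

definition Upoly :: "nat \<Rightarrow> complex \<Rightarrow> complex \<Rightarrow> complex \<Rightarrow> complex \<Rightarrow> complex" where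
  "Upoly n l0 l1 l2 z = l0 + of_nat n * l1 * z + (of_nat n * (of_nat n - 1) / 2) * l2 * z^2"

definition Phi :: "nat \<Rightarrow> real \<Rightarrow> real \<Rightarrow> real \<Rightarrow> complex \<Rightarrow> complex \<Rightarrow> complex" where
  "Phi n k R r \<alpha> \<beta> = \<beta> * (complex_of_real (((R + k) / (k + r))^n - cmod \<alpha>)) - \<alpha>"

end

theory Submission
  imports Defs "HOL-Complex_Analysis.Conformal_Mappings"
    "HOL-Computational_Algebra.Fundamental_Theorem_Algebra"
begin

text \<open>
  Fix \<open>z\<close> and regard \<open>L P = B[P \<circ> \<sigma>](z) + \<Phi> B[P \<circ> \<rho>](z)\<close> as a linear functional of \<open>P\<close>. It does not
  vanish on any polynomial \<open>F\<close> of exact degree \<open>n\<close> with all zeros in \<open>|w| < k\<close>: factor by factor,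
  \<open>|F(R w)| > ((R + k) / (r + k))\<^sup>n |F(r w)|\<close> for \<open>|w| \<ge> 1\<close>, and \<open>|\<Phi>| \<le> ((R + k) / (r + k))\<^sup>n\<close>, so
  \<open>F \<circ> \<sigma> + \<Phi> (F \<circ> \<rho>)\<close> has its zeros in the open unit disc. Factoring \<open>U\<close> into linear factors
  exhibits \<open>B\<close> at \<open>z\<close> as two successive polar derivatives with poles of modulus at least \<open>|z|\<close>, which do not
  vanish at \<open>z\<close> by Laguerre's theorem.

  Hence \<open>|p| \<le> |q|\<close> on \<open>|w| \<ge> k\<close> implies \<open>|L p| \<le> |L q|\<close> if \<open>q\<close> has degree \<open>n\<close> and no zeros there
  (otherwise \<open>p - \<lambda> q\<close> with \<open>\<lambda> = L p / L q\<close>, \<open>|\<lambda>| > 1\<close>, is a contradiction). In particular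
  \<open>|L P| \<le> |L Q|\<close> for \<open>P\<close> without zeros in \<open>|w| < k\<close> and \<open>Q\<close> its reciprocal with respect to
  \<open>|w| = k\<close>. Applied to \<open>P + c\<close> with \<open>|c|\<close> tending to the maximum, respectively the minimum, of \<open>|P|\<close> on
  \<open>|w| = k\<close> and \<open>c\<close> suitably rotated, this bounds \<open>|L P| + |L Q|\<close>, respectively
  \<open>|L P| - |L Q|\<close>; the theorem is half the sum of the two bounds.
\<close>

section \<open>Laguerre's theorem and polar derivatives\<close>

text \<open>Adding a point to a multiset of size \<open>m\<close> replaces the mean by a convex
  combination with weights \<open>m / (m + 1)\<close> and \<open>1 / (m + 1)\<close>. Multisets keep
  root multiplicities.\<close>

lemma convex_mean_mset:
  fixes S :: "'a::real_vector set"
  assumes "convex S" "A \<noteq> {#}" "set_mset A \<subseteq> S"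
  shows "(1 / real (size A)) *\<^sub>R sum_mset A \<in> S"
  using assms(2,3)
proof (induction A)
  case empty
  then show ?case by simp
next
  case (add x A)
  show ?case
  proof (cases "A = {#}")
    case True
    with add show ?thesis by simp
  next
    case False
    let ?m = "real (size A)"
    have m: "?m > 0" using False by (simp add: nonempty_has_size)
    have IH: "(1 / ?m) *\<^sub>R sum_mset A \<in> S" using add False by simp
    have "(?m / (?m + 1)) *\<^sub>R ((1 / ?m) *\<^sub>R sum_mset A) + (1 / (?m + 1)) *\<^sub>R x \<in> S"
      using add.prems IH m by (intro convexD[OF \<open>convex S\<close>]) (auto simp: field_simps)
    also have "(?m / (?m + 1)) *\<^sub>R ((1 / ?m) *\<^sub>R sum_mset A) + (1 / (?m + 1)) *\<^sub>R x
        = (1 / real (size (add_mset x A))) *\<^sub>R sum_mset (add_mset x A)"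
      using m by (simp add: scaleR_add_right add.commute)
    finally show ?thesis .
  qed
qed

section \<open>Root multisets, logarithmic derivative and leading coefficients\<close>

lemma poly_root_factorization:
  fixes p :: "complex poly"
  assumes "p \<noteq> 0"
  obtains A where "p = smult (lead_coeff p) (\<Prod>x\<in>#A. [:- x, 1:])" "size A = degree p"
    "\<And>w. w \<in># A \<longleftrightarrow> poly p w = 0"
  using that[of "proots p"] complex_poly_decompose_multiset[of p] assms
  by (simp add: size_proots_complex)

lemma log_pderiv_prod_mset:
  fixes w :: "'a::field"
  assumes "\<forall>x\<in>#A. x \<noteq> w"
  shows "poly (pderiv (\<Prod>x\<in>#A. [:- x, 1:])) w
    = poly (\<Prod>x\<in>#A. [:- x, 1:]) w * (\<Sum>x\<in>#A. 1 / (w - x))"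
  using assms by (induction A) (auto simp: pderiv_mult pderiv_pCons field_simps simp del: mult_pCons_left)

lemma degree_prod_linear_mset: "degree (\<Prod>x\<in>#A. [:- x, 1 :: 'a :: field:]) = size A"
proof (induction A)
  case (add x A)
  have "(\<Prod>x\<in>#A. [:- x, 1 :: 'a:]) \<noteq> 0" by auto
  with add show ?case
    using degree_mult_eq[of "[:- x, 1:]" "\<Prod>x\<in>#A. [:- x, 1 :: 'a:]"]
    by (simp del: mult_pCons_left)
qed simp

lemma monic_prod_linear_mset: "lead_coeff (\<Prod>x\<in>#A. [:- x, 1 :: 'a :: field:]) = 1"
proof (induction A)
  case (add x A)
  then show ?case
    using lead_coeff_mult[of "[:- x, 1:]" "\<Prod>x\<in>#A. [:- x, 1 :: 'a:]"]
    by (simp add: degree_prod_linear_mset del: mult_pCons_left)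
qed simp

lemma coeff_subleading_prod_linear_mset:
  assumes "size A = Suc n"
  shows "coeff (\<Prod>x\<in>#A. [:- x, 1 :: 'a :: field:]) n = - sum_mset A"
  using assms
proof (induction A arbitrary: n)
  case (add x A)
  show ?case
  proof (cases n)
    case 0
    with add.prems show ?thesis by simp
  next
    case (Suc m)
    with add.prems have s: "size A = Suc m" by simp
    have "coeff (\<Prod>x\<in>#A. [:- x, 1:]) (Suc m) = 1"
      using monic_prod_linear_mset[of A] by (simp only: degree_prod_linear_mset s)
    with add.IH[OF s] Suc show ?thesis by (simp add: algebra_simps)
  qed
qed simp

text \<open>Multiply by \<open>u\<close> and square. The result is a quadratic inequality in
  \<open>u\<close>, from which convexity can be read off.\<close>

lemma cmod_inverse_diff_set_eq:
  assumes "u \<noteq> 0"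
  shows "cmod (z - 1 / u) < 1 \<longleftrightarrow> ((cmod z)\<^sup>2 - 1) * (cmod u)\<^sup>2 + 1 < 2 * Re (z * u)"
proof -
  have "cmod (z - 1 / u) < 1 \<longleftrightarrow> cmod (z * u - 1) < cmod u"
  proof -
    have "z * u - 1 = (z - 1 / u) * u" using assms by (simp add: field_simps)
    then have "cmod (z * u - 1) = cmod (z - 1 / u) * cmod u" by (simp add: norm_mult)
    then show ?thesis using assms by simp
  qed
  also have "\<dots> \<longleftrightarrow> (cmod (z * u - 1))\<^sup>2 < (cmod u)\<^sup>2"
    by (simp add: power_mono_iff flip: not_le)
  also have "(cmod (z * u - 1))\<^sup>2 = (cmod z)\<^sup>2 * (cmod u)\<^sup>2 - 2 * Re (z * u) + 1"
    unfolding cmod_power2 by (simp add: algebra_simps power2_eq_square)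
  finally show ?thesis by (auto simp: algebra_simps)
qed

lemma convex_inverse_disc:
  assumes "1 \<le> cmod z"
  shows "convex {u. ((cmod z)\<^sup>2 - 1) * (cmod u)\<^sup>2 + 1 < 2 * Re (z * u)}"
proof (rule convexI)
  fix x y :: complex and a b :: real
  let ?c = "(cmod z)\<^sup>2 - 1"
  assume x: "x \<in> {u. ?c * (cmod u)\<^sup>2 + 1 < 2 * Re (z * u)}"
    and y: "y \<in> {u. ?c * (cmod u)\<^sup>2 + 1 < 2 * Re (z * u)}"
    and ab: "0 \<le> a" "0 \<le> b" "a + b = 1"
  have c: "0 \<le> ?c" using assms by (simp add: one_le_power)
  have b: "b = 1 - a" using ab by simp
  have "(cmod (a *\<^sub>R x + b *\<^sub>R y))\<^sup>2
      = a * (cmod x)\<^sup>2 + b * (cmod y)\<^sup>2 - a * b * (cmod (x - y))\<^sup>2"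
    unfolding cmod_power2 b by (simp add: algebra_simps power2_eq_square)
  also have "\<dots> \<le> a * (cmod x)\<^sup>2 + b * (cmod y)\<^sup>2" using ab by simp
  finally have "?c * (cmod (a *\<^sub>R x + b *\<^sub>R y))\<^sup>2 + 1
      \<le> ?c * (a * (cmod x)\<^sup>2 + b * (cmod y)\<^sup>2) + (a + b)"
    using c ab by (simp add: mult_left_mono)
  also have "\<dots> = a * (?c * (cmod x)\<^sup>2 + 1) + b * (?c * (cmod y)\<^sup>2 + 1)"
    by (simp add: algebra_simps)
  also have "\<dots> < a * (2 * Re (z * x)) + b * (2 * Re (z * y))"
  proof (cases "a = 0")
    case True
    then show ?thesis using y ab by simp
  next
    case False
    then show ?thesis using x y ab
      by (intro add_less_le_mono mult_strict_left_mono mult_left_mono) auto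
  qed
  also have "\<dots> = 2 * Re (z * (a *\<^sub>R x + b *\<^sub>R y))"
    by (simp add: algebra_simps)
  finally show "a *\<^sub>R x + b *\<^sub>R y \<in> {u. ?c * (cmod u)\<^sup>2 + 1 < 2 * Re (z * u)}" by simp
qed

text \<open>The quotient p'(z) / p(z) is the sum of the numbers 1 / (z - x) over the roots x. All of
  these lie in one convex set, hence so does their mean \<open>u\<close>, and
  \<open>w = z - 1 / u\<close> is a point of the unit disc that acts as a single root of full
  multiplicity.\<close>

lemma laguerre_center:
  fixes p :: "complex poly"
  assumes deg: "degree p \<ge> 1" and roots: "\<And>w. poly p w = 0 \<Longrightarrow> cmod w < 1" and z: "1 \<le> cmod z"
  obtains w where "cmod w < 1" "(z - w) * poly (pderiv p) z = of_nat (degree p) * poly p z"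
    "poly (pderiv p) z \<noteq> 0"
proof -
  have "p \<noteq> 0" using deg by auto
  from poly_root_factorization[OF this] obtain A
    where A: "p = smult (lead_coeff p) (\<Prod>x\<in>#A. [:- x, 1:])" "size A = degree p"
      "\<And>w. w \<in># A \<longleftrightarrow> poly p w = 0" by blast
  have ne: "\<forall>x\<in>#A. x \<noteq> z" using A(3) roots z by force
  define S where "S = {u. ((cmod z)\<^sup>2 - 1) * (cmod u)\<^sup>2 + 1 < 2 * Re (z * u)}"
  define u where "u = (1 / real (degree p)) *\<^sub>R (\<Sum>x\<in>#A. 1 / (z - x))"
  have "set_mset (image_mset (\<lambda>x. 1 / (z - x)) A) \<subseteq> S"
  proof clarsimp
    fix x assume "x \<in># A"
    then have "z - x \<noteq> 0" "cmod x < 1" using ne roots A(3) by auto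
    moreover from this have "cmod (z - 1 / (1 / (z - x))) < 1" by simp
    ultimately show "1 / (z - x) \<in> S"
      unfolding S_def mem_Collect_eq by (subst cmod_inverse_diff_set_eq[symmetric]) auto
  qed
  moreover have "A \<noteq> {#}" using A(2) deg by auto
  ultimately have "u \<in> S"
    unfolding u_def S_def using convex_mean_mset[OF convex_inverse_disc[OF z], of "image_mset (\<lambda>x. 1 / (z - x)) A"] A(2)
    by simp
  \<comment> \<open>At 0 the inequality defining \<open>S\<close> would read 1 < 0.\<close>
  then have u0: "u \<noteq> 0" unfolding S_def by auto
  then have w: "cmod (z - 1 / u) < 1"
    using \<open>u \<in> S\<close> unfolding S_def by (simp add: cmod_inverse_diff_set_eq)
  have "poly (pderiv p) z = poly p z * (\<Sum>x\<in>#A. 1 / (z - x))"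
    using log_pderiv_prod_mset[OF ne] by (subst A(1), subst (3) A(1)) (simp add: pderiv_smult)
  also have "(\<Sum>x\<in>#A. 1 / (z - x)) = of_nat (degree p) * u"
    unfolding u_def using deg by (simp add: scaleR_conv_of_real)
  finally have d: "poly (pderiv p) z = of_nat (degree p) * u * poly p z" by simp
  have "poly p z \<noteq> 0" using roots z by force
  show ?thesis
  proof (rule that[OF w])
    show "(z - (z - 1 / u)) * poly (pderiv p) z = of_nat (degree p) * poly p z"
      using u0 by (simp add: d)
    show "poly (pderiv p) z \<noteq> 0" using d u0 deg \<open>poly p z \<noteq> 0\<close> by auto
  qed
qed

text \<open>The polar derivative of \<open>p\<close> with respect to the point \<open>c / a\<close> of the Riemann sphere,
  where \<open>a = 0\<close> encodes the point at infinity.\<close>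

definition polar_deriv :: "complex \<Rightarrow> complex \<Rightarrow> complex poly \<Rightarrow> complex poly" where
  "polar_deriv a c p = smult (a * of_nat (degree p)) p + [:c, - a:] * pderiv p"

text \<open>Replacing \<open>degree p * p(z)\<close> by \<open>(z - w) * p'(z)\<close> with the
  Laguerre center \<open>w\<close> collapses the polar derivative to
  \<open>(c - a * w) * p'(z)\<close>, and |a w| < |c| since |w| < 1.\<close>

lemma polar_deriv_nonzero:
  assumes deg: "degree p \<ge> 1" and roots: "\<And>w. poly p w = 0 \<Longrightarrow> cmod w < 1" and z: "1 \<le> cmod z"
    and ac: "cmod a \<le> cmod c" "c \<noteq> 0"
  shows "poly (polar_deriv a c p) z \<noteq> 0"
proof -
  obtain w where w: "cmod w < 1" "(z - w) * poly (pderiv p) z = of_nat (degree p) * poly p z"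
    "poly (pderiv p) z \<noteq> 0"
    using laguerre_center[OF deg roots z] by blast
  have "poly (polar_deriv a c p) z = a * (of_nat (degree p) * poly p z) + (c - a * z) * poly (pderiv p) z"
    unfolding polar_deriv_def by (simp add: algebra_simps)
  also have "\<dots> = (c - a * w) * poly (pderiv p) z"
    unfolding w(2)[symmetric] by (simp add: algebra_simps)
  also have "\<dots> \<noteq> 0"
  proof -
    have "cmod (a * w) < cmod c"
    proof (cases "a = 0")
      case False
      then have "cmod (a * w) < cmod a" using w(1) by (simp add: norm_mult)
      with ac show ?thesis by simp
    qed (use ac in simp)
    then have "c - a * w \<noteq> 0" by auto
    with w(3) show ?thesis by simp
  qed
  finally show ?thesis .
qed

text \<open>The top coefficients cancel. The next one is the leading coefficient times
  \<open>c * (n + 1)\<close> minus \<open>a\<close> times the sum of the \<open>n + 1\<close> roots;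
  it survives because that sum has modulus less than \<open>n + 1\<close>.\<close>

lemma degree_polar_deriv:
  assumes deg: "degree p = Suc n" and roots: "\<And>w. poly p w = 0 \<Longrightarrow> cmod w < 1"
    and ac: "cmod a \<le> cmod c" "c \<noteq> 0"
  shows "degree (polar_deriv a c p) = n"
proof -
  have "p \<noteq> 0" using deg by auto
  from poly_root_factorization[OF this] obtain A
    where A: "p = smult (lead_coeff p) (\<Prod>x\<in>#A. [:- x, 1:])" "size A = degree p"
      "\<And>w. w \<in># A \<longleftrightarrow> poly p w = 0" by blast
  have "(1 / real (size A)) *\<^sub>R sum_mset A \<in> ball 0 1"
    using A roots deg by (intro convex_mean_mset) (auto simp: A(3) size_eq_Suc_imp_eq_union)
  then have sum: "cmod (sum_mset A) < Suc n"
    using A(2) deg by (simp add: field_simps)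
  have sub: "coeff p n = - lead_coeff p * sum_mset A"
    using coeff_subleading_prod_linear_mset[of A n] A(2) deg by (subst A(1)) simp
  have cf: "coeff (polar_deriv a c p) (Suc i)
      = a * (of_nat n - of_nat i) * coeff p (Suc i) + c * of_nat (i + 2) * coeff p (i + 2)" for i
    unfolding polar_deriv_def by (simp add: coeff_pCons coeff_pderiv deg algebra_simps)
  have cf0: "coeff (polar_deriv a c p) 0 = a * of_nat (Suc n) * coeff p 0 + c * coeff p 1"
    unfolding polar_deriv_def by (simp add: coeff_pderiv deg algebra_simps)
  have le: "degree (polar_deriv a c p) \<le> n"
  proof (rule degree_le, clarify)
    fix i assume "n < i"
    then obtain j where j: "i = Suc j" "n \<le> j" by (cases i) auto
    have "coeff p (j + 2) = 0" using j deg by (intro coeff_eq_0) auto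
    \<comment> \<open>For \<open>j = n\<close> the first factor vanishes, which is the cancellation
      of the top coefficients; for larger \<open>j\<close> the second one does.\<close>
    moreover have "(of_nat n - of_nat j) * coeff p (Suc j) = 0"
      using j deg by (cases "n = j") (auto intro!: coeff_eq_0)
    ultimately show "coeff (polar_deriv a c p) i = 0" by (simp add: cf j)
  qed
  have "coeff (polar_deriv a c p) n = a * coeff p n + c * of_nat (Suc n) * coeff p (Suc n)"
  proof (cases n)
    case 0
    then show ?thesis using cf0 by simp
  next
    case (Suc m)
    then show ?thesis using cf[of m] by (simp add: algebra_simps)
  qed
  also have "\<dots> = lead_coeff p * (c * of_nat (Suc n) - a * sum_mset A)"
    unfolding sub using deg by (simp add: algebra_simps)
  also have "\<dots> \<noteq> 0"
  proof -
    have "cmod (a * sum_mset A) \<le> cmod c * cmod (sum_mset A)"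
      using ac by (simp add: norm_mult mult_right_mono)
    also have "\<dots> < cmod c * Suc n" using sum ac by (intro mult_strict_left_mono) auto
    also have "\<dots> = cmod (c * of_nat (Suc n))" by (simp add: norm_mult del: of_nat_Suc)
    finally have "c * of_nat (Suc n) - a * sum_mset A \<noteq> 0" by auto
    with \<open>p \<noteq> 0\<close> show ?thesis by simp
  qed
  finally have "n \<le> degree (polar_deriv a c p)" by (rule le_degree)
  with le show ?thesis by simp
qed

section \<open>Factoring \<open>Upoly\<close> and nonvanishing of \<open>Bop\<close>\<close>

lemma complex_quadratic_factor:
  fixes q0 q1 q2 :: complex
  obtains a1 b1 a2 b2 where "q0 = a1 * a2" "q1 = a1 * b2 + a2 * b1" "q2 = b1 * b2"
proof (cases "q2 = 0")
  case True
  then show ?thesis using that[of q0 1 0 q1] by simp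
next
  case False
  define s where "s = csqrt (q1\<^sup>2 - 4 * q0 * q2)"
  have s: "s\<^sup>2 = q1\<^sup>2 - 4 * q0 * q2" by (simp add: s_def)
  show ?thesis
  \<comment> \<open>The roots of the quadratic are \<open>(- q1 \<plusminus> s) / (2 * q2)\<close>;
    the factor \<open>q2\<close> is moved into the second linear form.\<close>
  proof (rule that[of "(q1 - s) / 2" "(q1 + s) / (2 * q2)" 1 q2])
    have "(q1 - s) * (q1 + s) = 4 * q0 * q2" using s by (simp add: algebra_simps power2_eq_square)
    then show "q0 = (q1 - s) / 2 * ((q1 + s) / (2 * q2))" using False by (simp add: field_simps)
  qed (use False in \<open>auto simp: field_simps\<close>)
qed

text \<open>A zero -a/b of a linear factor a + b w of \<open>Upoly\<close> lies in the half-plane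
  exactly when |a| <= |a + b n/2|. This is the condition on the pole, with
  \<open>c = (a + b * n / 2) * z\<close>, under which a polar derivative does not vanish at
  \<open>z\<close>.\<close>

lemma Bop_nonzero:
  assumes n: "n \<ge> 1"
    and U: "\<forall>w. Upoly n l0 l1 l2 w = 0 \<longrightarrow> cmod w \<le> cmod (w - of_nat n / 2)"
    and deg: "degree p = n" and roots: "\<And>w. poly p w = 0 \<Longrightarrow> cmod w < 1" and z: "1 \<le> cmod z"
  shows "Bop n l0 l1 l2 p z \<noteq> 0"
proof -
  let ?N = "of_nat n :: complex"
  \<comment> \<open>The point n/2 is outside the half-plane, as its distance to n/2 is 0. This keeps
    the numerators of the poles nonzero.\<close>
  have U0: "Upoly n l0 l1 l2 (?N / 2) \<noteq> 0" using U n by force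
  have bound: "cmod a \<le> cmod (a + b * ?N / 2)"
    if "\<And>w. a + b * w = 0 \<Longrightarrow> cmod w \<le> cmod (w - ?N / 2)" for a b
  proof (cases "b = 0")
    case False
    then have "cmod (- a / b) \<le> cmod (- a / b - ?N / 2)" by (intro that) simp
    then have "cmod b * cmod (- a / b) \<le> cmod b * cmod (- a / b - ?N / 2)"
      by (rule mult_left_mono) simp
    moreover have "b * (- a / b) = - a" "b * (- a / b - ?N / 2) = - (a + b * ?N / 2)"
      using False by (simp_all add: right_diff_distrib)
    ultimately have "cmod (- a) \<le> cmod (- (a + b * ?N / 2))"
      unfolding norm_mult[symmetric] by (simp only:)
    then show ?thesis by (simp only: norm_minus_cancel)
  qed simp
  show ?thesis
  proof (cases "n = 1")
    case True
    \<comment> \<open>For n = 1 the quadratic terms of \<open>Upoly\<close> and \<open>Bop\<close>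
      vanish, and one polar derivative already gives \<open>Bop\<close>.\<close>
    let ?c = "l0 + l1 * ?N / 2"
    have Ueq: "Upoly n l0 l1 l2 w = l0 + l1 * w" for w
      using True by (simp add: Upoly_def)
    have "cmod l0 \<le> cmod ?c" using U by (intro bound) (simp add: Ueq)
    moreover have "?c \<noteq> 0" using U0 by (simp add: Ueq)
    ultimately have "poly (polar_deriv l0 (?c * z) p) z \<noteq> 0"
      using z n deg roots mult_mono[of 1 "cmod z" "cmod l0" "cmod ?c"]
      by (intro polar_deriv_nonzero) (auto simp: norm_mult mult.commute)
    moreover have "pderiv (pderiv p) = 0"
      using deg True by (simp add: pderiv_eq_0_iff degree_pderiv)
    ultimately show ?thesis
      using True deg by (simp add: polar_deriv_def Bop_def algebra_simps)
  next
    case False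
    define m where "m = n - 2"
    then have m: "n = Suc (Suc m)" using n False by simp
    obtain a1 b1 a2 b2 where q: "l0 = a1 * a2" "?N * l1 = a1 * b2 + a2 * b1"
      "?N * (?N - 1) / 2 * l2 = b1 * b2"
      using complex_quadratic_factor by blast
    have Ueq: "Upoly n l0 l1 l2 w = (a1 + b1 * w) * (a2 + b2 * w)" for w
      unfolding Upoly_def q by (simp add: algebra_simps power2_eq_square)
    define c1 c2 where "c1 = a1 + b1 * ?N / 2" and "c2 = a2 + b2 * ?N / 2"
    have c: "cmod a1 \<le> cmod c1" "cmod a2 \<le> cmod c2" "c1 \<noteq> 0" "c2 \<noteq> 0"
      unfolding c1_def c2_def using U U0 by (auto simp: Ueq intro!: bound)
    have z0: "z \<noteq> 0" using z by auto
    have cz: "cmod a1 \<le> cmod (c1 * z)" "cmod a2 \<le> cmod (c2 * z)"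
      using c(1,2) z mult_mono[of 1 "cmod z" "cmod a1" "cmod c1"] mult_mono[of 1 "cmod z" "cmod a2" "cmod c2"]
      by (auto simp: norm_mult mult.commute)
    define p1 where "p1 = polar_deriv a1 (c1 * z) p"
    have deg1: "degree p1 = Suc m"
      unfolding p1_def using deg roots c z0 cz m by (intro degree_polar_deriv) auto
    have roots1: "cmod w < 1" if "poly p1 w = 0" for w
      using polar_deriv_nonzero[of p w a1 "c1 * z"] that deg n roots cz c z0
      unfolding p1_def by force
    have p1z: "poly p1 z = ?N * a1 * poly p z + b1 * ?N / 2 * z * poly (pderiv p) z"
      unfolding p1_def polar_deriv_def c1_def by (simp add: algebra_simps deg)
    have p1'z: "poly (pderiv p1) z
        = a1 * (?N - 1) * poly (pderiv p) z + b1 * ?N / 2 * z * poly (pderiv (pderiv p)) z"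
      unfolding p1_def polar_deriv_def c1_def
      by (simp add: algebra_simps deg pderiv_add pderiv_smult pderiv_mult pderiv_pCons
          pderiv_diff pderiv_minus)
    have "poly (polar_deriv a2 (c2 * z) p1) z \<noteq> 0"
      using deg1 roots1 cz c z0 z by (intro polar_deriv_nonzero) auto
    also have "poly (polar_deriv a2 (c2 * z) p1) z
        = (?N - 1) * a2 * poly p1 z + b2 * ?N / 2 * z * poly (pderiv p1) z"
      unfolding polar_deriv_def c2_def by (simp add: algebra_simps deg1 m)
    also have "\<dots> = ?N * (?N - 1) * (a1 * a2) * poly p z
        + ?N * (?N - 1) * (a1 * b2 + a2 * b1) * z / 2 * poly (pderiv p) z
        + ?N\<^sup>2 * (b1 * b2) * z\<^sup>2 / 4 * poly (pderiv (pderiv p)) z"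
      unfolding p1z p1'z by (simp add: field_simps power2_eq_square)
    \<comment> \<open>The two polar derivatives bring in the degrees n and n - 1, whence the factor
      n(n - 1).\<close>
    also have "\<dots> = ?N * (?N - 1) * Bop n l0 l1 l2 p z"
      unfolding q[symmetric] Bop_def by (simp add: field_simps power2_eq_square)
    finally show ?thesis by auto
  qed
qed

section \<open>Growth under dilation\<close>

text \<open>The difference of the squared sides is R - r times an expression increasing in
  \<open>x\<close>, because k^2 < r R. At the extreme value \<open>x = - t * s\<close> it decreases
  in \<open>s\<close> and vanishes for \<open>s = k * t\<close>, so it is positive for
  \<open>s < k * t\<close>.\<close>

lemma dilation_factor_less:
  assumes k: "0 < k" "k \<le> r" and rR: "r < R" and w: "cmod w < k" and z: "1 \<le> cmod z"
  shows "(R + k) / (r + k) * cmod (of_real r * z - w) < cmod (of_real R * z - w)"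
proof -
  define t s x where "t = cmod z" and "s = cmod w" and "x = Re (z * cnj w)"
  have sq: "(cmod (of_real c * z - w))\<^sup>2 = c\<^sup>2 * t\<^sup>2 - 2 * c * x + s\<^sup>2" for c
    unfolding t_def s_def x_def cmod_power2 by (simp add: algebra_simps power2_eq_square)
  have x: "\<bar>x\<bar> \<le> t * s" unfolding t_def s_def x_def
    using abs_Re_le_cmod[of "z * cnj w"] by (simp add: norm_mult)
  have t: "1 \<le> t" and s: "0 \<le> s" "s < k" using z w by (auto simp: t_def s_def)
  have skt: "s < k * t" using s t k mult_left_mono[of 1 t k] by linarith
  have kk: "k\<^sup>2 < r * R" using k rR unfolding power2_eq_square by (intro mult_le_less_imp_less) auto
  have "x * (r * R - k\<^sup>2) \<ge> - (t * s) * (r * R - k\<^sup>2)"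
    using x kk by (intro mult_right_mono) auto
  moreover have "t * s * (r * R - k\<^sup>2) \<le> t * (k * t) * (r * R - k\<^sup>2)"
    using skt t kk by (intro mult_right_mono mult_left_mono) auto
  moreover have "s\<^sup>2 * (R + r + 2 * k) < (k * t)\<^sup>2 * (R + r + 2 * k)"
    using skt s k rR by (intro mult_strict_right_mono power_strict_mono) auto
  ultimately have pos: "0 < t\<^sup>2 * k * (2 * R * r + k * (R + r)) + 2 * (x * (r * R - k\<^sup>2)) - s\<^sup>2 * (R + r + 2 * k)"
    by (simp add: algebra_simps power2_eq_square)
  have "(r + k)\<^sup>2 * (cmod (of_real R * z - w))\<^sup>2 - (R + k)\<^sup>2 * (cmod (of_real r * z - w))\<^sup>2
      = (R - r) * (t\<^sup>2 * k * (2 * R * r + k * (R + r)) + 2 * (x * (r * R - k\<^sup>2)) - s\<^sup>2 * (R + r + 2 * k))"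
    unfolding sq by (simp add: algebra_simps power2_eq_square)
  also have "\<dots> > 0" using pos rR by simp
  finally have "((R + k) * cmod (of_real r * z - w))\<^sup>2 < ((r + k) * cmod (of_real R * z - w))\<^sup>2"
    by (simp add: power_mult_distrib)
  then have "(R + k) * cmod (of_real r * z - w) < (r + k) * cmod (of_real R * z - w)"
    by (rule power_less_imp_less_base) (use k in auto)
  then show ?thesis using k by (simp add: field_simps)
qed

lemma dilation_prod_less:
  assumes k: "0 < k" "k \<le> r" and rR: "r < R" and z: "1 \<le> cmod z"
    and A: "A \<noteq> {#}" "\<forall>w\<in>#A. cmod w < k"
  shows "((R + k) / (r + k)) ^ size A * (\<Prod>w\<in>#A. cmod (of_real r * z - w))
    < (\<Prod>w\<in>#A. cmod (of_real R * z - w))"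
  using A
proof (induction A)
  case (add w A)
  let ?c = "(R + k) / (r + k)"
  have c: "0 \<le> ?c" using k rR by simp
  have w: "?c * cmod (of_real r * z - w) < cmod (of_real R * z - w)"
    using add.prems by (intro dilation_factor_less k rR z) auto
  show ?case
  proof (cases "A = {#}")
    case True
    then show ?thesis using w by simp
  next
    case False
    have nn: "0 \<le> (\<Prod>w\<in>#A. cmod (of_real r * z - w))" by (induction A) auto
    have "(?c * cmod (of_real r * z - w)) * (?c ^ size A * (\<Prod>w\<in>#A. cmod (of_real r * z - w)))
       < cmod (of_real R * z - w) * (\<Prod>w\<in>#A. cmod (of_real R * z - w))"
      using add False w mult_nonneg_nonneg[OF c norm_ge_zero] mult_nonneg_nonneg[OF zero_le_power[OF c] nn]
      by (intro mult_strict_mono') auto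
    then show ?thesis by (simp add: mult_ac)
  qed
qed simp

lemma dilation_poly_less:
  fixes p :: "complex poly"
  assumes k: "0 < k" "k \<le> r" and rR: "r < R" and z: "1 \<le> cmod z"
    and deg: "degree p \<ge> 1" and roots: "\<And>w. poly p w = 0 \<Longrightarrow> cmod w < k"
  shows "((R + k) / (r + k)) ^ degree p * cmod (poly p (of_real r * z)) < cmod (poly p (of_real R * z))"
proof -
  have "p \<noteq> 0" using deg by auto
  from poly_root_factorization[OF this] obtain A
    where A: "p = smult (lead_coeff p) (\<Prod>x\<in>#A. [:- x, 1:])" "size A = degree p"
      "\<And>w. w \<in># A \<longleftrightarrow> poly p w = 0" by blast
  have norm_prod: "cmod (\<Prod>x\<in>#A. f x) = (\<Prod>x\<in>#A. cmod (f x))" for f :: "complex \<Rightarrow> complex"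
    by (induction A) (auto simp: norm_mult)
  have ev: "cmod (poly p y) = cmod (lead_coeff p) * (\<Prod>w\<in>#A. cmod (y - w))" for y
    by (subst A(1)) (simp add: poly_prod_mset norm_mult norm_prod)
  have "((R + k) / (r + k)) ^ size A * (\<Prod>w\<in>#A. cmod (of_real r * z - w))
    < (\<Prod>w\<in>#A. cmod (of_real R * z - w))"
    using A deg roots by (intro dilation_prod_less k rR z) auto
  then have "cmod (lead_coeff p) * (((R + k) / (r + k)) ^ size A * (\<Prod>w\<in>#A. cmod (of_real r * z - w)))
    < cmod (lead_coeff p) * (\<Prod>w\<in>#A. cmod (of_real R * z - w))"
    using \<open>p \<noteq> 0\<close> by (intro mult_strict_left_mono) auto
  then show ?thesis by (simp add: ev A(2) mult_ac)
qed

section \<open>Reciprocal polynomials\<close>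

text \<open>\<open>star k n p\<close> has the values \<open>(z / k)\<^sup>n * cnj (p (k\<^sup>2 / cnj z))\<close>: the reciprocal
  polynomial with respect to the circle of radius \<open>k\<close>, on which it has the same modulus as \<open>p\<close>.\<close>

definition star :: "real \<Rightarrow> nat \<Rightarrow> complex poly \<Rightarrow> complex poly" where
  "star k n p = (\<Sum>i\<le>n. monom (cnj (coeff p i) * of_real (k ^ (2 * i) / k ^ n)) (n - i))"

lemma coeff_star:
  assumes "i \<le> n"
  shows "coeff (star k n p) i = cnj (coeff p (n - i)) * of_real (k ^ (2 * (n - i)) / k ^ n)"
proof -
  have "coeff (star k n p) i
      = (\<Sum>j\<le>n. if n - i = j then cnj (coeff p j) * of_real (k ^ (2 * j) / k ^ n) else 0)"
    unfolding star_def coeff_sum coeff_monom using assms by (intro sum.cong) auto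
  then show ?thesis by simp
qed

lemma degree_star_le: "degree (star k n p) \<le> n"
  unfolding star_def by (intro degree_sum_le) (auto intro: order_trans[OF degree_monom_le])

lemma degree_star:
  assumes "poly p 0 \<noteq> 0" "k \<noteq> 0"
  shows "degree (star k n p) = n"
proof (rule antisym[OF degree_star_le le_degree])
  show "coeff (star k n p) n \<noteq> 0" using assms by (simp add: coeff_star poly_0_coeff_0)
qed

text \<open>Shifting \<open>p\<close> by a constant moves its reciprocal by a multiple of z^n, so
  one parameter \<open>c\<close> perturbs both polynomials in a controlled way.\<close>

lemma star_add_const:
  "star k n (p + [:c:]) = star k n p + smult (cnj c * of_real (1 / k ^ n)) (monom 1 n)"
proof -
  have "coeff (star k n (p + [:c:])) i
    = coeff (star k n p + smult (cnj c * of_real (1 / k ^ n)) (monom 1 n)) i" for i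
  proof (cases "i \<le> n")
    case True
    then show ?thesis
      by (cases "i = n") (auto simp: coeff_star coeff_pCons algebra_simps split: nat.splits)
  next
    case False
    then have "degree (star k n q) < i" for q using degree_star_le[of k n q] by simp
    then show ?thesis using False by (simp add: coeff_eq_0)
  qed
  then show ?thesis by (rule poly_eqI)
qed

lemma poly_star:
  assumes "degree p \<le> n" "k \<noteq> 0" "z \<noteq> 0"
  shows "poly (star k n p) z = (z / of_real k) ^ n * cnj (poly p (of_real (k\<^sup>2) / cnj z))"
proof -
  have "poly p x = (\<Sum>i\<le>n. coeff p i * x ^ i)" for x
    unfolding poly_altdef using assms(1)
    by (intro sum.mono_neutral_left) (auto simp: coeff_eq_0)
  then have "(z / of_real k) ^ n * cnj (poly p (of_real (k\<^sup>2) / cnj z))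
      = (\<Sum>i\<le>n. (z / of_real k) ^ n * (cnj (coeff p i) * (of_real (k\<^sup>2) / z) ^ i))"
    by (simp add: sum_distrib_left)
  also have "\<dots> = poly (star k n p) z"
    unfolding star_def poly_sum poly_monom
  proof (intro sum.cong refl)
    fix i assume "i \<in> {..n}"
    then have "z ^ n = z ^ i * z ^ (n - i)" by (simp flip: power_add)
    then show "(z / of_real k) ^ n * (cnj (coeff p i) * (of_real (k\<^sup>2) / z) ^ i)
        = cnj (coeff p i) * of_real (k ^ (2 * i) / k ^ n) * z ^ (n - i)"
      using assms by (simp add: power_divide power_mult)
  qed
  finally show ?thesis by simp
qed

lemma cmod_poly_star:
  assumes "degree p \<le> n" "0 < k" "z \<noteq> 0"
  shows "cmod (poly (star k n p) z) = (cmod z / k) ^ n * cmod (poly p (of_real (k\<^sup>2) / cnj z))"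
  using assms by (simp add: poly_star norm_mult norm_power norm_divide)

lemma cmod_reflected: "cmod (of_real (k\<^sup>2) / cnj z) = k\<^sup>2 / cmod z"
  by (simp add: norm_divide norm_power)

text \<open>The reflection of \<open>z\<close> in the circle of radius \<open>k\<close> falls into
  the closed disc, where \<open>p\<close> has no zero.\<close>

lemma star_nonzero:
  assumes "degree p \<le> n" "0 < k" "\<And>w. cmod w \<le> k \<Longrightarrow> poly p w \<noteq> 0" "k \<le> cmod z"
  shows "poly (star k n p) z \<noteq> 0"
proof -
  have "0 < cmod z" using assms by linarith
  moreover have "k\<^sup>2 / cmod z \<le> k"
    using assms \<open>0 < cmod z\<close> by (simp add: field_simps power2_eq_square)
  then have "poly p (of_real (k\<^sup>2) / cnj z) \<noteq> 0"
    by (intro assms(3)) (simp only: cmod_reflected)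
  ultimately show ?thesis using assms by (subst poly_star) auto
qed

text \<open>A Blaschke-type identity: |k^2 - cnj(z) w|^2 - k^2 |z - w|^2 = (|z|^2 - k^2)(|w|^2 -
  k^2).\<close>

lemma reflected_factor_le:
  assumes k: "0 < k" "k \<le> cmod w" "k \<le> cmod z"
  shows "cmod (z - w) \<le> cmod z / k * cmod (of_real (k\<^sup>2) / cnj z - w)"
proof -
  have z: "cmod z \<noteq> 0" using k by linarith
  have "(of_real (k\<^sup>2) / cnj z - w) * cnj z = of_real (k\<^sup>2) - cnj z * w"
    using z by (simp add: left_diff_distrib)
  then have "cmod (of_real (k\<^sup>2) / cnj z - w) * cmod z = cmod (of_real (k\<^sup>2) - cnj z * w)"
    by (metis complex_mod_cnj norm_mult)
  moreover have "k * cmod (z - w) \<le> cmod (of_real (k\<^sup>2) - cnj z * w)"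
  proof (rule power2_le_imp_le)
    have "(cmod (of_real (k\<^sup>2) - cnj z * w))\<^sup>2 - (k * cmod (z - w))\<^sup>2
        = ((cmod z)\<^sup>2 - k\<^sup>2) * ((cmod w)\<^sup>2 - k\<^sup>2)"
      unfolding power_mult_distrib cmod_power2 by (simp add: algebra_simps power2_eq_square)
    also have "\<dots> \<ge> 0" using k by (intro mult_nonneg_nonneg) (auto intro: power_mono)
    finally show "(k * cmod (z - w))\<^sup>2 \<le> (cmod (of_real (k\<^sup>2) - cnj z * w))\<^sup>2" by simp
  qed simp
  ultimately show ?thesis using k by (simp add: field_simps)
qed

text \<open>The bound for single factors is multiplied over the roots. If the degree is below
  \<open>n\<close>, the missing powers of |z| / k are at least 1.\<close>

lemma cmod_poly_le_star:
  fixes p :: "complex poly"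
  assumes deg: "degree p \<le> n" and k: "0 < k"
    and nz: "\<And>w. cmod w < k \<Longrightarrow> poly p w \<noteq> 0" and z: "k \<le> cmod z"
  shows "cmod (poly p z) \<le> cmod (poly (star k n p) z)"
proof -
  have "p \<noteq> 0" using nz[of 0] k by auto
  from poly_root_factorization[OF this] obtain A
    where A: "p = smult (lead_coeff p) (\<Prod>x\<in>#A. [:- x, 1:])" "size A = degree p"
      "\<And>w. w \<in># A \<longleftrightarrow> poly p w = 0" by blast
  define y where "y = of_real (k\<^sup>2) / cnj z"
  have ev: "poly p x = lead_coeff p * (\<Prod>w\<in>#A. x - w)" for x
    by (subst A(1)) (simp add: poly_prod_mset)
  have roots: "\<forall>w\<in>#A. k \<le> cmod w" using A(3) nz by force
  have "cmod (\<Prod>w\<in>#A. z - w) \<le> (cmod z / k) ^ size A * cmod (\<Prod>w\<in>#A. y - w)"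
    using roots
  proof (induction A)
    case (add w A)
    have "cmod (z - w) * cmod (\<Prod>w\<in>#A. z - w)
       \<le> (cmod z / k * cmod (y - w)) * ((cmod z / k) ^ size A * cmod (\<Prod>w\<in>#A. y - w))"
      using add k z unfolding y_def
      by (intro mult_mono reflected_factor_le) auto
    then show ?case by (simp add: norm_mult mult_ac)
  qed simp
  then have "cmod (lead_coeff p) * cmod (\<Prod>w\<in>#A. z - w)
      \<le> cmod (lead_coeff p) * ((cmod z / k) ^ size A * cmod (\<Prod>w\<in>#A. y - w))"
    by (rule mult_left_mono) simp
  then have "cmod (poly p z) \<le> (cmod z / k) ^ degree p * cmod (poly p y)"
    by (simp add: ev norm_mult A(2) mult.left_commute)
  also have "\<dots> \<le> (cmod z / k) ^ n * cmod (poly p y)"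
    using deg k z by (intro mult_right_mono power_increasing) (auto simp: field_simps)
  also have "\<dots> = cmod (poly (star k n p) z)"
    unfolding y_def using deg k z by (subst cmod_poly_star) auto
  finally show ?thesis .
qed

text \<open>Comparing the reciprocal polynomials near 0 gives the comparison of the coefficients.\<close>

lemma coeff_le_of_poly_le:
  fixes p q :: "complex poly"
  assumes deg: "degree p \<le> n" "degree q \<le> n" and k: "0 < k"
    and le: "\<And>w. k \<le> cmod w \<Longrightarrow> cmod (poly p w) \<le> cmod (poly q w)"
  shows "cmod (coeff p n) \<le> cmod (coeff q n)"
proof -
  have "((\<lambda>z. cmod (poly (star k n r) z)) \<longlongrightarrow> cmod (poly (star k n r) 0)) (at 0)" for r
    by (intro tendsto_intros)
  moreover have "eventually (\<lambda>z. cmod (poly (star k n p) z) \<le> cmod (poly (star k n q) z)) (at 0)"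
    unfolding eventually_at
  proof (intro exI[of _ k] conjI ballI impI k)
    fix z :: complex assume z: "z \<noteq> 0 \<and> dist z 0 < k"
    \<comment> \<open>Reflection sends a punctured neighbourhood of 0 into the region where
      \<open>le\<close> applies.\<close>
    then have "k \<le> k\<^sup>2 / cmod z" using k by (simp add: field_simps power2_eq_square)
    then have "k \<le> cmod (of_real (k\<^sup>2) / cnj z)" by (simp only: cmod_reflected)
    then show "cmod (poly (star k n p) z) \<le> cmod (poly (star k n q) z)"
      using z deg k le by (simp add: cmod_poly_star mult_left_mono del: of_real_power)
  qed
  ultimately have "cmod (poly (star k n p) 0) \<le> cmod (poly (star k n q) 0)"
    by (intro tendsto_le[of "at 0"]) auto
  then have "cmod (coeff p n) * k ^ n \<le> cmod (coeff q n) * k ^ n"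
    using k by (simp add: poly_0_coeff_0 coeff_star norm_mult norm_divide norm_power
      mult_2 power_add)
  then show ?thesis using k by simp
qed

section \<open>Functionals not vanishing on polynomials with zeros in a disc\<close>

text \<open>The rotation makes \<open>a\<close> point opposite to \<open>b\<close>. The conjugate is
  there because \<open>c\<close> enters the reciprocal of \<open>p + [:c:]\<close> as
  \<open>cnj c\<close>.\<close>

lemma exists_rotation_cmod_add:
  fixes a b :: complex
  obtains \<mu> where "cmod \<mu> = 1" "cmod (b + cnj \<mu> * a) = \<bar>cmod b - cmod a\<bar>"
proof (cases "a = 0 \<or> b = 0")
  case True
  then show ?thesis using that[of 1] by auto
next
  case False
  define \<nu> where "\<nu> = - sgn b / sgn a"
  have "cmod \<nu> = 1" using False by (simp add: \<nu>_def norm_divide norm_sgn)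
  moreover have "b + \<nu> * a = sgn b * of_real (cmod b - cmod a)"
    using False by (simp add: \<nu>_def sgn_div_norm scaleR_conv_of_real field_simps)
  then have "cmod (b + \<nu> * a) = \<bar>cmod b - cmod a\<bar>"
    using False by (simp only: norm_mult norm_of_real) (simp add: norm_sgn)
  ultimately show ?thesis using that[of "cnj \<nu>"] by simp
qed

text \<open>These are the only properties of the operator that the comparison argument uses:
  linearity, and nonvanishing on polynomials of exact degree \<open>n\<close> with all zeros in the
  open disc.\<close>

locale disc_nonvanishing_functional =
  fixes L :: "complex poly \<Rightarrow> complex" and n :: nat and k :: real
  assumes add: "L (p + q) = L p + L q"
    and smult: "L (smult c p) = c * L p"
    and nonvanishing: "\<lbrakk>degree p = n; \<And>w. poly p w = 0 \<Longrightarrow> cmod w < k\<rbrakk> \<Longrightarrow> L p \<noteq> 0"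
    and k_pos: "0 < k"
begin

lemma zero: "L 0 = 0"
  using smult[of 0 0] by simp

lemma sum: "L (\<Sum>i\<in>I. f i) = (\<Sum>i\<in>I. L (f i))"
  by (induction I rule: infinite_finite_induct) (auto simp: add zero)

lemma compare:
  assumes deg: "degree p \<le> n" "degree q = n"
    and nz: "\<And>w. k \<le> cmod w \<Longrightarrow> poly q w \<noteq> 0"
    and le: "\<And>w. k \<le> cmod w \<Longrightarrow> cmod (poly p w) \<le> cmod (poly q w)"
  shows "cmod (L p) \<le> cmod (L q)"
proof (rule ccontr)
  assume gt: "\<not> cmod (L p) \<le> cmod (L q)"
  have Lq: "L q \<noteq> 0" using nz deg(2) not_le by (intro nonvanishing) blast+
  define c where "c = L p / L q"
  have c: "1 < cmod c" using gt Lq by (simp add: c_def norm_divide)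
  have less: "cmod x < cmod (c * y)" if "cmod x \<le> cmod y" "y \<noteq> 0" for x y
  proof -
    have "1 * cmod y < cmod c * cmod y" using c that by (intro mult_strict_right_mono) auto
    with \<open>cmod x \<le> cmod y\<close> show ?thesis unfolding norm_mult by linarith
  qed
  define F where "F = p + smult (- c) q"
  have "L F = 0" using Lq by (simp add: F_def add smult c_def del: smult_minus_left)
  moreover have "L F \<noteq> 0"
  proof (rule nonvanishing)
    have "q \<noteq> 0" using nz[of "of_real k"] k_pos by auto
    then have "coeff q n \<noteq> 0" using deg by auto
    \<comment> \<open>Since |c| > 1, the leading coefficients cannot cancel, so \<open>F\<close> has
      exact degree \<open>n\<close>.\<close>
    then have "cmod (coeff p n) < cmod (c * coeff q n)"
      using coeff_le_of_poly_le[OF deg(1) _ k_pos le] deg(2) by (intro less) auto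
    then have "n \<le> degree F" by (intro le_degree) (auto simp: F_def)
    moreover have "degree F \<le> n"
      unfolding F_def using deg degree_smult_le[of "- c" q] by (intro degree_add_le) auto
    ultimately show "degree F = n" by simp
  next
    fix w assume "poly F w = 0"
    then have "poly p w = c * poly q w" by (simp add: F_def)
    with less[OF le nz, of w] show "cmod w < k" by fastforce
  qed
  ultimately show False by contradiction
qed

text \<open>Zeros of \<open>p\<close> on the circle of radius \<open>k\<close> are zeros of its
  reciprocal too, which rules out a direct use of \<open>compare\<close>. Reciprocals for radii
  \<open>s < k\<close> have no zeros in |w| >= k, and \<open>s\<close> then tends to
  \<open>k\<close>.\<close>

lemma cmod_le_star:
  assumes deg: "degree p \<le> n" and nz: "\<And>w. cmod w < k \<Longrightarrow> poly p w \<noteq> 0"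
  shows "cmod (L p) \<le> cmod (L (star k n p))"
proof -
  \<comment> \<open>Written out by linearity, the value is a continuous function of
    \<open>s\<close>.\<close>
  have Ls: "L (star s n p) = (\<Sum>i\<le>n. cnj (coeff p i) * of_real (s ^ (2 * i) / s ^ n) * L (monom 1 (n - i)))" for s
    unfolding star_def sum by (simp add: smult[symmetric] smult_monom del: of_real_divide of_real_power)
  have "((\<lambda>s. cmod (L (star s n p))) \<longlongrightarrow> cmod (L (star k n p))) (at_left k)"
    unfolding Ls using k_pos by (intro tendsto_intros) auto
  moreover have "eventually (\<lambda>s. cmod (L p) \<le> cmod (L (star s n p))) (at_left k)"
    using eventually_at_left_real[OF k_pos]
  proof eventually_elim
    case (elim s)
    then have s: "0 < s" "s < k" by auto
    then show ?case
      using deg nz by (intro compare degree_star star_nonzero[OF deg] cmod_poly_le_star) auto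
  qed
  ultimately show ?thesis by (intro tendsto_lowerbound) auto
qed

text \<open>The comparison polynomial M (w/k)^n is the reciprocal of the constant
  \<open>M\<close>.\<close>

lemma cmod_star_le_max:
  assumes deg: "degree p \<le> n" and M: "0 < M" and le: "\<And>w. cmod w \<le> k \<Longrightarrow> cmod (poly p w) \<le> M"
  shows "cmod (L (star k n p)) \<le> M * (cmod (L (monom 1 n)) / k ^ n)"
proof -
  define q where "q = smult (of_real (M / k ^ n)) (monom 1 n :: complex poly)"
  have q: "cmod (poly q w) = (cmod w / k) ^ n * M" for w
    unfolding q_def using M k_pos by (simp add: poly_monom norm_mult norm_power norm_divide power_divide)
  have "cmod (L (star k n p)) \<le> cmod (L q)"
  proof (rule compare[OF degree_star_le])
    show "degree q = n" using M k_pos by (simp add: q_def degree_monom_eq)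
  next
    fix w assume w: "k \<le> cmod w"
    then have w0: "0 < cmod w" using k_pos by linarith
    then have "cmod (poly q w) \<noteq> 0" unfolding q using M k_pos by simp
    then show "poly q w \<noteq> 0" by auto
    have "k\<^sup>2 / cmod w \<le> k" using w k_pos w0 by (simp add: field_simps power2_eq_square)
    then have "cmod (poly p (of_real (k\<^sup>2) / cnj w)) \<le> M" by (intro le) (simp only: cmod_reflected)
    then show "cmod (poly (star k n p) w) \<le> cmod (poly q w)"
      unfolding q using w0 k_pos deg by (subst cmod_poly_star) (auto intro!: mult_left_mono)
  qed
  also have "\<dots> = M * (cmod (L (monom 1 n)) / k ^ n)"
    using M k_pos by (simp add: q_def smult norm_mult norm_divide norm_power)
  finally show ?thesis .
qed

text \<open>The same comparison with the roles exchanged: as \<open>m\<close> is positive,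
  \<open>p\<close> has no zero in the closed disc, so its reciprocal can serve as the
  majorant.\<close>

lemma cmod_star_ge_min:
  assumes deg: "degree p \<le> n" and m: "0 < m" and le: "\<And>w. cmod w \<le> k \<Longrightarrow> m \<le> cmod (poly p w)"
  shows "m * (cmod (L (monom 1 n)) / k ^ n) \<le> cmod (L (star k n p))"
proof -
  have nz: "poly p w \<noteq> 0" if "cmod w \<le> k" for w using le[OF that] m by auto
  define q where "q = smult (of_real (m / k ^ n)) (monom 1 n :: complex poly)"
  have q: "cmod (poly q w) = (cmod w / k) ^ n * m" for w
    unfolding q_def using m k_pos by (simp add: poly_monom norm_mult norm_power norm_divide power_divide)
  have "m * (cmod (L (monom 1 n)) / k ^ n) = cmod (L q)"
    using m k_pos by (simp add: q_def smult norm_mult norm_divide norm_power)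
  also have "\<dots> \<le> cmod (L (star k n p))"
  proof (rule compare)
    show "degree q \<le> n" unfolding q_def by (intro order_trans[OF degree_smult_le] degree_monom_le)
    show "degree (star k n p) = n" using nz[of 0] k_pos by (intro degree_star) auto
  next
    fix w assume w: "k \<le> cmod w"
    then have w0: "0 < cmod w" using k_pos by linarith
    show "poly (star k n p) w \<noteq> 0" using star_nonzero[OF deg k_pos nz w] .
    have "k\<^sup>2 / cmod w \<le> k" using w k_pos w0 by (simp add: field_simps power2_eq_square)
    then have "m \<le> cmod (poly p (of_real (k\<^sup>2) / cnj w))" by (intro le) (simp only: cmod_reflected)
    then show "cmod (poly q w) \<le> cmod (poly (star k n p) w)"
      unfolding q using w0 k_pos deg by (subst cmod_poly_star) (auto intro!: mult_left_mono)
  qed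
  finally show ?thesis .
qed

lemma L_star_add_const:
  "L (star k n (p + [:c:])) = L (star k n p) + cnj c * (L (monom 1 n) / of_real (k ^ n))"
  unfolding star_add_const add smult by simp

lemma L_add_const: "L (p + [:c:]) = L p + c * L 1"
  using smult[of c 1] add[of p "[:c:]"] by (simp add: one_pCons)

lemma add_star_le_max:
  assumes deg: "degree p \<le> n" and M: "0 < M" and le: "\<And>w. cmod w \<le> k \<Longrightarrow> cmod (poly p w) \<le> M"
  shows "cmod (L p) + cmod (L (star k n p)) \<le> M * (cmod (L (monom 1 n)) / k ^ n + cmod (L 1))"
proof -
  define E where "E = L (monom 1 n) / of_real (k ^ n)"
  have cmod_E: "cmod E = cmod (L (monom 1 n)) / k ^ n" using k_pos by (simp add: E_def norm_divide norm_power)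
  have *: "cmod (L p) + cmod (L (star k n p)) \<le> t * (cmod E + cmod (L 1))" if t: "M < t" for t
  proof -
    obtain \<mu> where \<mu>: "cmod \<mu> = 1"
      "cmod (L (star k n p) + cnj \<mu> * (of_real t * E)) = \<bar>cmod (L (star k n p)) - cmod (of_real t * E)\<bar>"
      by (rule exists_rotation_cmod_add)
    define c where "c = \<mu> * of_real t"
    have c: "cmod c = t" using \<mu> t M by (simp add: c_def norm_mult)
    have tE: "cmod (of_real t * E) = t * (cmod (L (monom 1 n)) / k ^ n)"
      unfolding norm_mult cmod_E using t M by simp
    have "cmod (L (star k n p)) \<le> cmod (of_real t * E)"
      \<comment> \<open>This decides the sign inside the absolute value produced by the
        rotation.\<close>
      unfolding tE using t M by (intro cmod_star_le_max[OF deg] order_trans[OF le]) auto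
    then have eq: "cmod (L (star k n p) + cnj c * E) = t * cmod E - cmod (L (star k n p))"
      using \<mu> t M by (simp add: c_def norm_mult mult.assoc)
    have "cmod (L (p + [:c:])) \<le> cmod (L (star k n (p + [:c:])))"
    proof (rule cmod_le_star)
      show "degree (p + [:c:]) \<le> n" using deg by (intro degree_add_le) auto
      fix w assume "cmod w < k"
      \<comment> \<open>The strict inequality \<open>M < t\<close> keeps \<open>p + [:c:]\<close>
        free of zeros; the limit \<open>t\<close> to \<open>M\<close> is taken afterwards.\<close>
      then have "cmod (poly p w) < cmod c" using le[of w] c t by simp
      then have "poly p w + c \<noteq> 0" by (metis add_eq_0_iff2 less_irrefl norm_minus_cancel)
      then show "poly (p + [:c:]) w \<noteq> 0" by simp
    qed
    then have "cmod (L p + c * L 1) \<le> t * cmod E - cmod (L (star k n p))"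
      unfolding L_add_const L_star_add_const[folded E_def] eq .
    moreover have "cmod (L p) - t * cmod (L 1) \<le> cmod (L p + c * L 1)"
      using norm_diff_ineq[of "L p" "c * L 1"] c by (simp add: norm_mult)
    ultimately show ?thesis by (simp add: algebra_simps)
  qed
  have "cmod (L p) + cmod (L (star k n p)) \<le> M * (cmod E + cmod (L 1))"
  proof (rule tendsto_lowerbound)
    show "((\<lambda>t. t * (cmod E + cmod (L 1))) \<longlongrightarrow> M * (cmod E + cmod (L 1))) (at_right M)"
      by (intro tendsto_intros)
    show "\<forall>\<^sub>F t in at_right M. cmod (L p) + cmod (L (star k n p)) \<le> t * (cmod E + cmod (L 1))"
      using eventually_at_right_less[of M] by eventually_elim (rule *)
  qed simp
  then show ?thesis unfolding cmod_E .
qed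

lemma add_min_le_star:
  assumes deg: "degree p \<le> n" and m: "0 \<le> m" and le: "\<And>w. cmod w \<le> k \<Longrightarrow> m \<le> cmod (poly p w)"
    and nz: "\<And>w. cmod w < k \<Longrightarrow> poly p w \<noteq> 0"
  shows "cmod (L p) + m * (cmod (L (monom 1 n)) / k ^ n - cmod (L 1)) \<le> cmod (L (star k n p))"
proof (cases "m = 0")
  case True
  then show ?thesis using cmod_le_star[OF deg nz] by simp
next
  case False
  with m have m0: "0 < m" by simp
  define E where "E = L (monom 1 n) / of_real (k ^ n)"
  have cmod_E: "cmod E = cmod (L (monom 1 n)) / k ^ n" using k_pos by (simp add: E_def norm_divide norm_power)
  have *: "cmod (L p) + t * (cmod E - cmod (L 1)) \<le> cmod (L (star k n p))" if t: "0 < t" "t < m" for t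
  proof -
    obtain \<mu> where \<mu>: "cmod \<mu> = 1"
      "cmod (L (star k n p) + cnj \<mu> * (of_real t * E)) = \<bar>cmod (L (star k n p)) - cmod (of_real t * E)\<bar>"
      by (rule exists_rotation_cmod_add)
    define c where "c = \<mu> * of_real t"
    have c: "cmod c = t" using \<mu> t by (simp add: c_def norm_mult)
    have tE: "cmod (of_real t * E) = t * (cmod (L (monom 1 n)) / k ^ n)"
      unfolding norm_mult cmod_E using t by simp
    have "cmod (of_real t * E) \<le> cmod (L (star k n p))"
      unfolding tE using t by (intro cmod_star_ge_min[OF deg] order_trans[OF _ le]) auto
    then have eq: "cmod (L (star k n p) + cnj c * E) = cmod (L (star k n p)) - t * cmod E"
      using \<mu> t by (simp add: c_def norm_mult mult.assoc)
    have "cmod (L (p + [:c:])) \<le> cmod (L (star k n (p + [:c:])))"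
    proof (rule cmod_le_star)
      show "degree (p + [:c:]) \<le> n" using deg by (intro degree_add_le) auto
      fix w assume "cmod w < k"
      \<comment> \<open>Here \<open>t < m\<close> lets \<open>p\<close> dominate the constant, so
        again no zero arises.\<close>
      then have "cmod c < cmod (poly p w)" using le[of w] c t by simp
      then have "poly p w + c \<noteq> 0" by (metis add_eq_0_iff2 less_irrefl norm_minus_cancel)
      then show "poly (p + [:c:]) w \<noteq> 0" by simp
    qed
    then have "cmod (L p + c * L 1) \<le> cmod (L (star k n p)) - t * cmod E"
      unfolding L_add_const L_star_add_const[folded E_def] eq .
    moreover have "cmod (L p) - t * cmod (L 1) \<le> cmod (L p + c * L 1)"
      using norm_diff_ineq[of "L p" "c * L 1"] c by (simp add: norm_mult)
    ultimately show ?thesis by (simp add: algebra_simps)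
  qed
  have "cmod (L p) + m * (cmod E - cmod (L 1)) \<le> cmod (L (star k n p))"
  proof (rule tendsto_upperbound)
    show "((\<lambda>t. cmod (L p) + t * (cmod E - cmod (L 1))) \<longlongrightarrow> cmod (L p) + m * (cmod E - cmod (L 1))) (at_left m)"
      by (intro tendsto_intros)
    show "\<forall>\<^sub>F t in at_left m. cmod (L p) + t * (cmod E - cmod (L 1)) \<le> cmod (L (star k n p))"
      using eventually_at_left_real[OF m0] by eventually_elim (rule *, auto)
  qed simp
  then show ?thesis unfolding cmod_E .
qed

text \<open>Adding the two bounds cancels the reciprocal term and leaves twice the modulus of
  \<open>L p\<close>.\<close>

lemma cmod_le_max_min:
  assumes deg: "degree p \<le> n" and nz: "\<And>w. cmod w < k \<Longrightarrow> poly p w \<noteq> 0"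
    and M: "\<And>w. cmod w \<le> k \<Longrightarrow> cmod (poly p w) \<le> M"
    and m: "0 \<le> m" "\<And>w. cmod w \<le> k \<Longrightarrow> m \<le> cmod (poly p w)"
  shows "cmod (L p) \<le> 1 / 2 * ((cmod (L (monom 1 n)) / k ^ n + cmod (L 1)) * M
    - (cmod (L (monom 1 n)) / k ^ n - cmod (L 1)) * m)"
proof -
  have "0 < cmod (poly p 0)" using nz[of 0] k_pos by simp
  also have "\<dots> \<le> M" using M[of 0] k_pos by simp
  finally have "0 < M" .
  from add_star_le_max[OF deg this M] add_min_le_star[OF deg m nz] show ?thesis
    by (simp add: mult.commute)
qed

end

section \<open>The functional of the theorem\<close>

lemma Bop_add: "Bop n l0 l1 l2 (p + q) z = Bop n l0 l1 l2 p z + Bop n l0 l1 l2 q z"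
  unfolding Bop_def by (simp add: pderiv_add algebra_simps add_divide_distrib)

lemma Bop_smult: "Bop n l0 l1 l2 (smult c p) z = c * Bop n l0 l1 l2 p z"
  unfolding Bop_def by (simp add: pderiv_smult algebra_simps)

lemma pcompose_monom_linear:
  "pcompose (monom 1 n) [:0, a :: 'a :: comm_semiring_1:] = smult (a ^ n) (monom 1 n)"
  by (rule poly_eqI) (simp add: coeff_pcompose_linear coeff_monom)

text \<open>The growth constant is at least 1, hence at least |\<alpha>|, so the triangle inequality
  loses |\<alpha>| once and regains it.\<close>

lemma cmod_Phi_le:
  assumes "0 < k" "k \<le> r" "r < R" "cmod \<alpha> \<le> 1" "cmod \<beta> \<le> 1"
  shows "cmod (Phi n k R r \<alpha> \<beta>) \<le> ((R + k) / (r + k)) ^ n"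
proof -
  let ?c = "((R + k) / (r + k)) ^ n"
  have "1 \<le> ?c" using assms by (intro one_le_power) (simp add: field_simps)
  then have c: "0 \<le> ?c - cmod \<alpha>" using assms by linarith
  have "cmod (Phi n k R r \<alpha> \<beta>) \<le> cmod (\<beta> * of_real (?c - cmod \<alpha>)) + cmod \<alpha>"
    unfolding Phi_def add.commute[of k r] by (rule norm_triangle_ineq4)
  also have "cmod (\<beta> * of_real (?c - cmod \<alpha>)) = cmod \<beta> * (?c - cmod \<alpha>)"
    unfolding norm_mult norm_of_real using c by simp
  also have "\<dots> \<le> ?c - cmod \<alpha>" using c assms(5) by (intro mult_left_le_one_le) auto
  finally show ?thesis by simp
qed

text \<open>The first dilate strictly dominates the second times \<Phi> outside the open unit disc.
  The same domination for leading coefficients, from \<open>(R + k) / (r + k) * r < R\<close>, keeps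
  the degree.\<close>

lemma dilation_combination_roots:
  fixes p :: "complex poly"
  assumes n: "n \<ge> 1" and k: "0 < k" "k \<le> r" and rR: "r < R"
    and \<Phi>: "cmod \<Phi> \<le> ((R + k) / (r + k)) ^ n"
    and deg: "degree p = n" and roots: "\<And>w. poly p w = 0 \<Longrightarrow> cmod w < k"
  defines "q \<equiv> pcompose p [:0, of_real R:] + smult \<Phi> (pcompose p [:0, of_real r:])"
  shows "degree q = n" "poly q w = 0 \<Longrightarrow> cmod w < 1"
proof -
  have "\<Phi> * of_real r ^ n \<noteq> - (of_real R ^ n)"
  proof -
    have "cmod (\<Phi> * of_real r ^ n) \<le> ((R + k) / (r + k)) ^ n * r ^ n"
      unfolding norm_mult norm_power using \<Phi> k rR by (intro mult_mono) auto
    also have "\<dots> = ((R + k) / (r + k) * r) ^ n" by (simp only: power_mult_distrib)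
    also have "\<dots> < R ^ n"
    proof (rule power_strict_mono)
      show "(R + k) / (r + k) * r < R" using k rR by (simp add: field_simps)
    qed (use k rR n in auto)
    also have "\<dots> = cmod (- (of_real R ^ n))" using k rR by (simp add: norm_power)
    finally show ?thesis by auto
  qed
  then have "of_real R ^ n + \<Phi> * of_real r ^ n \<noteq> 0" by (simp add: add_eq_0_iff)
  moreover have "coeff q n = (of_real R ^ n + \<Phi> * of_real r ^ n) * lead_coeff p"
    unfolding q_def using deg by (simp add: coeff_pcompose_linear algebra_simps)
  moreover have "p \<noteq> 0" using deg n by auto
  ultimately have "n \<le> degree q" by (intro le_degree) simp
  moreover have "degree q \<le> n"
    by (rule degree_le) (simp add: q_def coeff_pcompose_linear coeff_eq_0 deg)
  ultimately show "degree q = n" by simp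
  show "cmod w < 1" if "poly q w = 0"
  proof (rule ccontr)
    assume "\<not> cmod w < 1"
    then have "((R + k) / (r + k)) ^ n * cmod (poly p (of_real r * w)) < cmod (poly p (of_real R * w))"
      using dilation_poly_less[of k r R w p] k rR roots deg n by auto
    moreover have "cmod (\<Phi> * poly p (of_real r * w))
        \<le> ((R + k) / (r + k)) ^ n * cmod (poly p (of_real r * w))"
      unfolding norm_mult using \<Phi> by (rule mult_right_mono) simp
    moreover have "poly p (of_real R * w) = - (\<Phi> * poly p (of_real r * w))"
      using that by (simp add: q_def poly_pcompose mult.commute eq_neg_iff_add_eq_0)
    ultimately show False by simp
  qed
qed

lemma disc_nonvanishing_functional_Bop:
  assumes n: "n \<ge> 1" and U: "\<forall>w. Upoly n l0 l1 l2 w = 0 \<longrightarrow> cmod w \<le> cmod (w - of_nat n / 2)"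
    and k: "0 < k" "k \<le> r" and rR: "r < R" and z: "1 \<le> cmod z"
    and \<Phi>: "cmod \<Phi> \<le> ((R + k) / (r + k)) ^ n"
  shows "disc_nonvanishing_functional (\<lambda>p. Bop n l0 l1 l2 (pcompose p [:0, of_real R:]) z
    + \<Phi> * Bop n l0 l1 l2 (pcompose p [:0, of_real r:]) z) n k"
proof
  fix p :: "complex poly"
  assume deg: "degree p = n" and roots: "\<And>w. poly p w = 0 \<Longrightarrow> cmod w < k"
  show "Bop n l0 l1 l2 (pcompose p [:0, of_real R:]) z
    + \<Phi> * Bop n l0 l1 l2 (pcompose p [:0, of_real r:]) z \<noteq> 0"
    using Bop_nonzero[OF n U dilation_combination_roots[OF n k rR \<Phi> deg roots] z]
    by (simp add: Bop_add Bop_smult)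
qed (use k in \<open>simp_all add: pcompose_add pcompose_smult Bop_add Bop_smult distrib_left mult.left_commute\<close>)

section \<open>Maximum and minimum modulus on the disc, and the final estimate\<close>

lemma poly_max_modulus:
  assumes k: "0 < k" and M: "\<And>w. cmod w = k \<Longrightarrow> cmod (poly p w) \<le> M" and w: "cmod w \<le> k"
  shows "cmod (poly p w) \<le> M"
proof (rule maximum_modulus_frontier[of "poly p" "cball 0 k"])
  show "poly p holomorphic_on interior (cball 0 k)" by (intro holomorphic_intros)
  show "continuous_on (closure (cball 0 k)) (poly p)" by (intro continuous_intros)
  show "cmod (poly p y) \<le> M" if "y \<in> frontier (cball 0 k)" for y
    using that M k by simp
qed (use w in auto)

text \<open>For positive \<open>m\<close> there are no zeros on the closed disc, and the maximum
  principle applies to the inverse of the polynomial.\<close>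

lemma poly_min_modulus:
  assumes k: "0 < k" and m: "\<And>w. cmod w = k \<Longrightarrow> m \<le> cmod (poly p w)"
    and nz: "\<And>w. cmod w < k \<Longrightarrow> poly p w \<noteq> 0" and w: "cmod w \<le> k"
  shows "m \<le> cmod (poly p w)"
proof (cases "0 < m")
  case True
  have nz': "poly p w \<noteq> 0" if "cmod w \<le> k" for w
    using that nz[of w] m[of w] True by (cases "cmod w = k") auto
  have "cmod (inverse (poly p w)) \<le> inverse m"
  proof (rule maximum_modulus_frontier[of "\<lambda>w. inverse (poly p w)" "cball 0 k"])
    show "(\<lambda>w. inverse (poly p w)) holomorphic_on interior (cball 0 k)"
      using nz by (auto intro!: holomorphic_intros)
    show "continuous_on (closure (cball 0 k)) (\<lambda>w. inverse (poly p w))"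
      using nz' by (auto intro!: continuous_intros)
    show "cmod (inverse (poly p y)) \<le> inverse m" if "y \<in> frontier (cball 0 k)" for y
      using that True m[of y] k by (simp add: norm_inverse le_imp_inverse_le)
  qed (use w in auto)
  then show ?thesis using True nz'[OF w] by (simp add: norm_inverse)
next
  case False
  then show ?thesis by (meson norm_ge_zero not_le order_trans less_imp_le)
qed

theorem theorem2p7:
  fixes n :: nat and k R r :: real and l0 l1 l2 \<alpha> \<beta> z :: complex and P :: "complex poly"
  assumes hn: "n \<ge> 1"
    and hU: "\<forall>w. Upoly n l0 l1 l2 w = 0 \<longrightarrow> cmod w \<le> cmod (w - of_nat n / 2)"
    and hk: "0 < k" "k \<le> 1"
    and hP: "degree P \<le> n"
    and hzeros: "\<forall>w. cmod w < k \<longrightarrow> poly P w \<noteq> 0"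
    and h\<alpha>: "cmod \<alpha> \<le> 1" and h\<beta>: "cmod \<beta> \<le> 1"
    and hRr: "R > r" "r \<ge> k"
    and hz: "cmod z = 1"
  shows "let \<Phi> = Phi n k R r \<alpha> \<beta>;
             Bzn = cmod (Bop n l0 l1 l2 (monom 1 n) z);
             M = (SUP w\<in>{w. cmod w = k}. cmod (poly P w));
             m = (INF w\<in>{w. cmod w = k}. cmod (poly P w))
         in cmod (Bop n l0 l1 l2 (pcompose P [:0, complex_of_real R:]) z
                  + \<Phi> * Bop n l0 l1 l2 (pcompose P [:0, complex_of_real r:]) z)
            \<le> (1/2) * ((Bzn / k^n * cmod (complex_of_real (R^n) + complex_of_real (r^n) * \<Phi>)
                        + cmod (1 + \<Phi>) * cmod l0) * M
                       - (Bzn / k^n * cmod (complex_of_real (R^n) + complex_of_real (r^n) * \<Phi>)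
                        - cmod (1 + \<Phi>) * cmod l0) * m)"
proof -
  define \<Phi> where "\<Phi> = Phi n k R r \<alpha> \<beta>"
  define L where "L p = Bop n l0 l1 l2 (pcompose p [:0, complex_of_real R:]) z
                  + \<Phi> * Bop n l0 l1 l2 (pcompose p [:0, complex_of_real r:]) z" for p
  have \<Phi>: "cmod \<Phi> \<le> ((R + k) / (r + k)) ^ n"
    unfolding \<Phi>_def using assms by (intro cmod_Phi_le) auto
  interpret disc_nonvanishing_functional L n k
    unfolding L_def using \<Phi> assms by (intro disc_nonvanishing_functional_Bop) auto
  let ?C = "{w. cmod w = k}"
  define M m where "M = (SUP w\<in>?C. cmod (poly P w))" and "m = (INF w\<in>?C. cmod (poly P w))"
  have "compact ?C" using compact_sphere[of "0 :: complex" k] by (simp add: sphere_def)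
  then have "bounded ((\<lambda>w. cmod (poly P w)) ` ?C)"
    by (intro compact_imp_bounded compact_continuous_image continuous_intros)
  then have bdd: "bdd_above ((\<lambda>w. cmod (poly P w)) ` ?C)" "bdd_below ((\<lambda>w. cmod (poly P w)) ` ?C)"
    by (simp_all add: bounded_imp_bdd_above bounded_imp_bdd_below)
  have "complex_of_real k \<in> ?C" using hk by simp
  then have "?C \<noteq> {}" by blast
  then have m0: "0 \<le> m" unfolding m_def by (intro cINF_greatest) auto
  have circle: "cmod (poly P y) \<le> M" "m \<le> cmod (poly P y)" if "cmod y = k" for y
    unfolding M_def m_def using that by (intro cSUP_upper cINF_lower bdd; simp)+
  have M: "cmod (poly P w) \<le> M" if "cmod w \<le> k" for w
    using hk(1) circle(1) that by (rule poly_max_modulus)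
  have m: "m \<le> cmod (poly P w)" if "cmod w \<le> k" for w
    using poly_min_modulus[OF hk(1) circle(2) _ that] hzeros by blast
  \<comment> \<open>The values of \<open>L\<close> at z^n and at 1 supply the two constants of the
    bound.\<close>
  have "L (monom 1 n) = (of_real (R ^ n) + of_real (r ^ n) * \<Phi>) * Bop n l0 l1 l2 (monom 1 n) z"
    by (simp add: L_def pcompose_monom_linear Bop_smult algebra_simps)
  then have Ln: "cmod (L (monom 1 n)) / k ^ n = cmod (Bop n l0 l1 l2 (monom 1 n) z) / k ^ n
      * cmod (of_real (R ^ n) + of_real (r ^ n) * \<Phi>)"
    by (simp only: norm_mult) simp
  have "L 1 = (1 + \<Phi>) * l0" by (simp add: L_def Bop_def pcompose_1 algebra_simps)
  then have L1: "cmod (L 1) = cmod (1 + \<Phi>) * cmod l0" by (simp only: norm_mult)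
  have "cmod (L P) \<le> 1 / 2 * ((cmod (L (monom 1 n)) / k ^ n + cmod (L 1)) * M
      - (cmod (L (monom 1 n)) / k ^ n - cmod (L 1)) * m)"
    using hzeros by (intro cmod_le_max_min[OF hP _ M m0 m]) auto
  then show ?thesis
    unfolding Ln L1 unfolding L_def M_def m_def \<Phi>_def Let_def .
qed

end
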